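(* Let $\mathcal{A}$ be a $\sigma$-finite W*-algebra or an AW*-algebra, let $n$ be a natural number, and let $M,N\in M_n(\mathcal{A})$ be positive. Let $U=[u_{j,k}]_{1\le j,k\le n}$ and $V=[v_{j,k}]_{1\le j,k\le n}$ in $M_n(\mathcal{A})$ be unitary matrices such that $$M=U\,\mathrm{diag}(\lambda_1,\dots,\lambda_n)\,U^*,\qquad N=V\,\mathrm{diag}(\mu_1,\dots,\mu_n)\,V^*$$ for some $\lambda_1,\dots,\lambda_n,\mu_1,\dots,\mu_n\in\mathcal{A}$, where $\mathrm{diag}(\cdot)$ denotes the diagonal matrix with the listed diagonal entries. If all $\lambda_j,\mu_k,u_{l,m},v_{r,s}$, $1\le j,k,l,m,r,s\le n$, commute with each other, then the Schur product $M\circ N$ is also positive.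
   Context: $M_n(\mathcal{A})$ is the *-algebra of $n\times n$ matrices over $\mathcal{A}$ with the natural matrix operations and involution $[a_{j,k}]^*=[a_{k,j}^*]$. On $\mathcal{A}^n$ (column vectors, on which matrices act by left multiplication) use the $\mathcal{A}$-valued inner product $\langle (x_j)_{j=1}^n,(y_j)_{j=1}^n\rangle=\sum_{j=1}^n x_jy_j^*$. A matrix $A\in M_n(\mathcal{A})$ is called positive if $A=A^*$ and $\langle Ax,x\rangle\ge 0$ in $\mathcal{A}$ for all $x\in\mathcal{A}^n$. The C*-algebraic Schur product of $A=[a_{j,k}]$ and $B=[b_{j,k}]$ in $M_n(\mathcal{A})$ is $A\circ B=\frac12[a_{j,k}b_{j,k}+b_{j,k}a_{j,k}]_{1\le j,k\le n}$. A W*-algebra is $\sigma$-finite if it contains no more than a countable set of mutually orthogonal projections. A C*-algebra $\mathcal{A}$ is an AW*-algebra if (i) any set of orthogonal projections has a supremum, and (ii) any maximal commutative self-adjoint subalgebra of $\mathcal{A}$ is generated by its projections. *)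

theory Defs
  imports "HOL-Analysis.Analysis"
begin

class complex_banach = banach +
  fixes scaleC :: "complex \<Rightarrow> 'a \<Rightarrow> 'a"  (infixr "*\<^sub>C" 75)
  assumes scaleC_add_right: "c *\<^sub>C (x + y) = c *\<^sub>C x + c *\<^sub>C y"
    and scaleC_add_left: "(c + d) *\<^sub>C x = c *\<^sub>C x + d *\<^sub>C x"
    and scaleC_scaleC: "c *\<^sub>C d *\<^sub>C x = (c * d) *\<^sub>C x"
    and scaleC_of_real: "complex_of_real r *\<^sub>C x = r *\<^sub>R x"
    and norm_scaleC: "norm (c *\<^sub>C x) = cmod c * norm x"

text \<open>
  Unital C*-algebras; the superclass \<open>real_normed_algebra_1\<close> supplies \<open>norm 1 = 1\<close>, which
  only excludes the zero algebra.
\<close>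

class cstar_algebra = complex_banach + real_normed_algebra_1 +
  fixes star :: "'a \<Rightarrow> 'a"
  assumes scaleC_mult_left: "(c *\<^sub>C x) * y = c *\<^sub>C (x * y)"
    and scaleC_mult_right: "x * (c *\<^sub>C y) = c *\<^sub>C (x * y)"
    and star_add: "star (x + y) = star x + star y"
    and star_scaleC: "star (c *\<^sub>C x) = cnj c *\<^sub>C star x"
    and star_mult: "star (x * y) = star y * star x"
    and star_star: "star (star x) = x"
    and cstar_identity: "norm (star x * x) = (norm x)\<^sup>2"

definition spectrum :: "'a::cstar_algebra \<Rightarrow> complex set" where
  "spectrum a = {c. \<not> (\<exists>b. (a - c *\<^sub>C 1) * b = 1 \<and> b * (a - c *\<^sub>C 1) = 1)}"

definition positive :: "'a::cstar_algebra \<Rightarrow> bool" where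
  "positive a \<longleftrightarrow> star a = a \<and> spectrum a \<subseteq> \<real>\<^sub>\<ge>\<^sub>0"

definition projection :: "'a::cstar_algebra \<Rightarrow> bool" where
  "projection p \<longleftrightarrow> star p = p \<and> p * p = p"

definition orthogonal_projections :: "'a::cstar_algebra set \<Rightarrow> bool" where
  "orthogonal_projections P \<longleftrightarrow>
     (\<forall>p\<in>P. projection p) \<and> (\<forall>p\<in>P. \<forall>q\<in>P. p \<noteq> q \<longrightarrow> p * q = 0)"

definition bounded_functional :: "('p::complex_banach \<Rightarrow> complex) \<Rightarrow> bool" where
  "bounded_functional f \<longleftrightarrow> bounded_linear f \<and> (\<forall>c x. f (c *\<^sub>C x) = c * f x)"

text \<open>
  Sakai's definition: a W*-algebra is a C*-algebra that is, as a Banach space, isometrically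
  isomorphic to the dual of some Banach space. HOL cannot quantify existentially over types,
  so the predual is a second type argument. In a theorem that assumes
  \<open>wstar_algebra TYPE('a) TYPE('p)\<close> and does not otherwise mention \<open>'p\<close>, the implicit
  universal quantification over \<open>'p\<close> amounts to assuming that some predual exists.
\<close>

definition wstar_algebra :: "'a::cstar_algebra itself \<Rightarrow> 'p::complex_banach itself \<Rightarrow> bool" where
  "wstar_algebra _ _ \<longleftrightarrow>
     (\<exists>T :: 'a \<Rightarrow> 'p \<Rightarrow> complex.
        (\<forall>a b x. T (a + b) x = T a x + T b x) \<and>
        (\<forall>c a x. T (c *\<^sub>C a) x = c * T a x) \<and>
        (\<forall>a. onorm (T a) = norm a) \<and>
        range T = {f. bounded_functional f})"

definition sigma_finite :: "'a::cstar_algebra itself \<Rightarrow> bool" where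
  "sigma_finite _ \<longleftrightarrow> (\<forall>P :: 'a set. orthogonal_projections P \<longrightarrow> countable P)"

text \<open>
  Suprema are taken in the set of all projections, ordered by \<open>p \<le> q \<longleftrightarrow> p = p * q\<close>.
\<close>

definition proj_le :: "'a::cstar_algebra \<Rightarrow> 'a \<Rightarrow> bool" where
  "proj_le p q \<longleftrightarrow> p = p * q"

definition proj_is_sup :: "'a::cstar_algebra set \<Rightarrow> 'a \<Rightarrow> bool" where
  "proj_is_sup P s \<longleftrightarrow>
     projection s \<and> (\<forall>p\<in>P. proj_le p s) \<and>
     (\<forall>q. projection q \<and> (\<forall>p\<in>P. proj_le p q) \<longrightarrow> proj_le s q)"

definition star_subalgebra :: "'a::cstar_algebra set \<Rightarrow> bool" where
  "star_subalgebra B \<longleftrightarrow>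
     0 \<in> B \<and> (\<forall>x\<in>B. \<forall>y\<in>B. x + y \<in> B) \<and> (\<forall>c. \<forall>x\<in>B. c *\<^sub>C x \<in> B) \<and>
     (\<forall>x\<in>B. \<forall>y\<in>B. x * y \<in> B) \<and> (\<forall>x\<in>B. star x \<in> B)"

definition commutative_set :: "'a::cstar_algebra set \<Rightarrow> bool" where
  "commutative_set S \<longleftrightarrow> (\<forall>x\<in>S. \<forall>y\<in>S. x * y = y * x)"

definition maximal_commutative_star_subalgebra :: "'a::cstar_algebra set \<Rightarrow> bool" where
  "maximal_commutative_star_subalgebra B \<longleftrightarrow>
     star_subalgebra B \<and> commutative_set B \<and>
     (\<forall>C. star_subalgebra C \<and> commutative_set C \<and> B \<subseteq> C \<longrightarrow> C = B)"

text \<open>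
  As usual for C*-algebras, \<open>generated\<close> means generated as a norm-closed *-subalgebra.
\<close>

definition awstar_algebra :: "'a::cstar_algebra itself \<Rightarrow> bool" where
  "awstar_algebra _ \<longleftrightarrow>
     (\<forall>P :: 'a set. orthogonal_projections P \<longrightarrow> (\<exists>s. proj_is_sup P s)) \<and>
     (\<forall>B :: 'a set. maximal_commutative_star_subalgebra B \<longrightarrow>
        (\<lambda>S. star_subalgebra S \<and> closed S) hull {p \<in> B. projection p} = B)"

definition matrix_star :: "'a::cstar_algebra ^ 'n ^ 'n \<Rightarrow> 'a ^ 'n ^ 'n" where
  "matrix_star A = (\<chi> j k. star (A $ k $ j))"

definition cstar_inner :: "'a::cstar_algebra ^ 'n \<Rightarrow> 'a ^ 'n \<Rightarrow> 'a" where
  "cstar_inner x y = (\<Sum>j\<in>UNIV. x $ j * star (y $ j))"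

definition matrix_positive :: "'a::cstar_algebra ^ 'n ^ 'n \<Rightarrow> bool" where
  "matrix_positive A \<longleftrightarrow> A = matrix_star A \<and> (\<forall>x. positive (cstar_inner (A *v x) x))"

definition unitary_matrix :: "'a::cstar_algebra ^ 'n ^ 'n \<Rightarrow> bool" where
  "unitary_matrix U \<longleftrightarrow> U ** matrix_star U = mat 1 \<and> matrix_star U ** U = mat 1"

definition diag :: "('n \<Rightarrow> 'a::cstar_algebra) \<Rightarrow> 'a ^ 'n ^ 'n" where
  "diag d = (\<chi> j k. if j = k then d j else 0)"

definition schur_product ::
  "'a::cstar_algebra ^ 'n ^ 'n \<Rightarrow> 'a ^ 'n ^ 'n \<Rightarrow> 'a ^ 'n ^ 'n" where
  "schur_product A B = (\<chi> j k. (1/2) *\<^sub>R (A $ j $ k * B $ j $ k + B $ j $ k * A $ j $ k))"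

end

theory Submission
  imports Defs
begin

text \<open>
  The value \<open>\<langle>M x, x\<rangle>\<close> is \<open>\<Sum>j k. m\<^sub>j\<^sub>k x\<^sub>k x\<^sub>j\<^sup>*\<close>, with the coefficient to the left of both
  coordinates. That this is self-adjoint for every \<open>x\<close> is a strong condition: polarisation
  shows that each entry \<open>m\<^sub>j\<^sub>k\<close> commutes with the whole algebra
  (\<open>matrix_positive_entry_central\<close>). Hence the Schur product has entries \<open>m\<^sub>j\<^sub>k n\<^sub>j\<^sub>k\<close>, it is
  Hermitian, and the classical argument for Schur's theorem can be carried out over the centre.

  That argument splits \<open>M\<close> into positive multiples of rank-one matrices. For a rank-one matrix
  with entries \<open>v\<^sub>j\<^sup>* c v\<^sub>k\<close>, where the \<open>v\<^sub>k\<close> are central and \<open>c\<close> is central and positive, the form of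
  its Schur product with \<open>N\<close> at \<open>x\<close> equals \<open>c \<langle>N y, y\<rangle>\<close> with \<open>y\<^sub>k = v\<^sub>k x\<^sub>k\<close>, a product of commuting
  positive elements. The splitting is Gaussian elimination: a diagonal entry, made invertible by
  adding \<open>\<epsilon>\<close>, splits off a rank-one matrix and leaves a Schur complement that is positive with one
  index less (\<open>schur_complement_positive\<close>, \<open>schur_product_form_positive\<close>).

  The C*-algebraic input is that the positive elements, defined through the
  spectrum, form a closed cone containing the products of commuting positive elements. The key to
  this is the description of positivity by \<open>norm (t - a) \<le> t\<close> (\<open>positive_if_norm_le\<close>,
  \<open>positive_norm_le\<close>). It rests on the fact that a self-adjoint element attains its norm
  on the spectrum up to sign, which is derived here from square roots obtained by a contraction
  argument and from \<open>(norm x)\<^sup>2 \<le> norm (x\<^sup>2 + y\<^sup>2)\<close> for commuting self-adjoint \<open>x\<close> and \<open>y\<close>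
  (\<open>norm_selfadjoint_less\<close>).
\<close>

section \<open>Scalars and the involution\<close>

lemma scaleC_one [simp]: "1 *\<^sub>C x = (x::'a::complex_banach)"
  using scaleC_of_real[of 1 x] by simp

lemma scaleC_zero_left [simp]: "0 *\<^sub>C x = (0::'a::complex_banach)"
  using scaleC_of_real[of 0 x] by simp

lemma scaleC_minus_right: "c *\<^sub>C (- x) = - (c *\<^sub>C (x::'a::complex_banach))"
  using scaleC_add_right[of c x "- x"] norm_scaleC[of c "0::'a"]
  by (simp add: eq_neg_iff_add_eq_0 add.commute)

lemma scaleC_minus_left: "(- c) *\<^sub>C x = - (c *\<^sub>C (x::'a::complex_banach))"
  using scaleC_add_left[of c "- c" x] by (simp add: eq_neg_iff_add_eq_0 add.commute)

lemma scaleC_diff_right: "c *\<^sub>C (x - y) = c *\<^sub>C x - c *\<^sub>C (y::'a::complex_banach)"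
  using scaleC_add_right[of c x "- y"] by (simp add: scaleC_minus_right)

lemma scaleC_of_real_one: "complex_of_real r *\<^sub>C 1 = (of_real r :: 'a::cstar_algebra)"
  unfolding scaleC_of_real by (simp add: of_real_def)

lemma star_scaleR: "star (r *\<^sub>R x) = r *\<^sub>R star (x::'a::cstar_algebra)"
  using star_scaleC[of "complex_of_real r" x] by (simp add: scaleC_of_real)

lemma star_zero [simp]: "star 0 = (0::'a::cstar_algebra)"
  using star_scaleR[of 0 "0::'a"] by simp

lemma star_minus: "star (- x) = - star (x::'a::cstar_algebra)"
  using star_scaleR[of "-1" x] by simp

lemma star_diff: "star (x - y) = star x - star (y::'a::cstar_algebra)"
  using star_add[of x "- y"] by (simp add: star_minus)

lemma star_one [simp]: "star 1 = (1::'a::cstar_algebra)"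
  using star_mult[of "star (1::'a)" 1] by (simp add: star_star)

lemma star_of_real [simp]: "star (of_real r) = (of_real r :: 'a::cstar_algebra)"
  by (simp add: of_real_def star_scaleR)

lemma star_sum: "star (sum f I) = (\<Sum>i\<in>I. star (f i :: 'a::cstar_algebra))"
  by (induction I rule: infinite_finite_induct) (simp_all add: star_add)

lemma norm_star: "norm (star x) = norm (x::'a::cstar_algebra)"
proof -
  have le: "norm y \<le> norm (star y)" for y :: 'a
  proof -
    have "norm y * norm y \<le> norm (star y) * norm y"
      using cstar_identity[of y] norm_mult_ineq[of "star y" y] by (simp add: power2_eq_square)
    then show ?thesis
      by (cases "y = 0") (auto simp: mult_le_cancel_right)
  qed
  show ?thesis
    using le[of x] le[of "star x"] by (simp add: star_star)
qed

lemma bounded_linear_star: "bounded_linear (star :: 'a::cstar_algebra \<Rightarrow> 'a)"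
  by (rule bounded_linear_intro[where K=1]) (simp_all add: star_add star_scaleR norm_star)

lemma of_real_mult_commute: "of_real r * x = x * (of_real r :: 'a::real_algebra_1)"
  by (simp add: of_real_def)

section \<open>Invertibility and the spectrum of a self-adjoint element\<close>

definition unit_element :: "'a::monoid_mult \<Rightarrow> bool" where
  "unit_element a \<longleftrightarrow> (\<exists>b. a * b = 1 \<and> b * a = 1)"

lemma not_in_spectrum_iff: "c \<notin> spectrum a \<longleftrightarrow> unit_element (a - c *\<^sub>C 1)"
  by (simp add: spectrum_def unit_element_def)

lemma unit_element_mult:
  assumes "unit_element a" "unit_element b"
  shows "unit_element (a * b)"
proof -
  obtain a' b' where "a * a' = 1" "a' * a = 1" "b * b' = 1" "b' * b = 1"
    using assms by (auto simp: unit_element_def)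
  then have "(a * b) * (b' * a') = 1" "(b' * a') * (a * b) = 1"
    by (metis mult.assoc mult_1_left)+
  then show ?thesis
    by (auto simp: unit_element_def)
qed

lemma unit_element_scaleC:
  assumes "c \<noteq> 0"
  shows "unit_element (c *\<^sub>C (1::'a::cstar_algebra))"
  unfolding unit_element_def
  by (rule exI[of _ "inverse c *\<^sub>C 1"])
     (simp add: scaleC_mult_left scaleC_scaleC assms)

text \<open>Both one-sided inverses of \<open>1 - x\<close> are fixed points of contractions, \<open>y = 1 + x * y\<close>
  and \<open>z = 1 + z * x\<close>; associativity makes them equal.\<close>

lemma unit_element_one_minus:
  fixes x :: "'a::{real_normed_algebra_1, banach}"
  assumes "norm x < 1"
  shows "unit_element (1 - x)"
proof -
  have "\<exists>!y. 1 + x * y = y"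
    by (rule banach_fix_type[of "norm x"])
       (use assms in \<open>auto simp: dist_norm norm_mult_ineq simp flip: right_diff_distrib\<close>)
  then obtain y where y: "1 + x * y = y" by auto
  have "\<exists>!z. 1 + z * x = z"
    by (rule banach_fix_type[of "norm x"])
       (use assms in \<open>auto simp: dist_norm mult.commute[of "norm x"] norm_mult_ineq
          simp flip: left_diff_distrib\<close>)
  then obtain z where z: "1 + z * x = z" by auto
  have "(1 - x) * y = 1" "z * (1 - x) = 1"
    using y z by (simp_all add: algebra_simps)
  moreover from this have "z = y"
    by (metis mult.assoc mult_1_left mult_1_right)
  ultimately show ?thesis
    by (auto simp: unit_element_def)
qed

lemma spectrum_norm_le:
  fixes a :: "'a::cstar_algebra"
  assumes "c \<in> spectrum a"
  shows "cmod c \<le> norm a"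
proof (rule ccontr)
  assume "\<not> cmod c \<le> norm a"
  then have lt: "norm a < cmod c" by simp
  then have c: "c \<noteq> 0" by auto
  have "norm (inverse c *\<^sub>C a) = norm a / cmod c"
    by (simp add: norm_scaleC norm_inverse divide_inverse mult.commute)
  then have "norm (inverse c *\<^sub>C a) < 1"
    using lt c by simp
  then have "unit_element (((- c) *\<^sub>C 1) * (1 - inverse c *\<^sub>C a))"
    by (intro unit_element_mult unit_element_scaleC unit_element_one_minus) (use c in auto)
  also have "((- c) *\<^sub>C 1) * (1 - inverse c *\<^sub>C a) = a - c *\<^sub>C 1"
    using c by (simp add: scaleC_mult_left scaleC_diff_right scaleC_scaleC scaleC_minus_left)
  finally show False
    using assms not_in_spectrum_iff by blast
qed

text \<open>Shifting by \<open>\<i> t\<close> moves the spectrum by \<open>\<i> t\<close>, while the C*-identity bounds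
  \<open>norm (a + \<i> t)\<close> by \<open>sqrt ((norm a)\<^sup>2 + t\<^sup>2)\<close>. A spectral value with nonzero imaginary
  part would therefore leave the disc that contains the spectrum for large \<open>t\<close>.\<close>

lemma spectrum_selfadjoint_real:
  fixes a :: "'a::cstar_algebra"
  assumes sa: "star a = a" and c: "c \<in> spectrum a"
  shows "c \<in> \<real>"
proof -
  have ineq: "(Im c + t)\<^sup>2 \<le> (norm a)\<^sup>2 + t\<^sup>2" for t :: real
  proof -
    let ?it = "\<i> * complex_of_real t"
    let ?b = "a + ?it *\<^sub>C 1"
    have "?b - (c + ?it) *\<^sub>C 1 = a - c *\<^sub>C 1"
      by (simp add: scaleC_add_left)
    then have "c + ?it \<in> spectrum ?b"
      using c not_in_spectrum_iff by metis
    then have "cmod (c + ?it) \<le> norm ?b"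
      by (rule spectrum_norm_le)
    moreover have "\<bar>Im c + t\<bar> \<le> cmod (c + ?it)"
      using abs_Im_le_cmod[of "c + ?it"] by simp
    ultimately have "(Im c + t)\<^sup>2 \<le> (norm ?b)\<^sup>2"
      by (metis abs_le_square_iff abs_norm_cancel order_trans)
    also have "\<dots> = norm (star ?b * ?b)"
      by (simp add: cstar_identity)
    also have "star ?b * ?b = a * a + (t\<^sup>2) *\<^sub>R 1"
    proof -
      have sb: "star ?b = a - ?it *\<^sub>C 1"
        by (simp add: star_add star_scaleC sa scaleC_minus_left)
      have "star ?b * ?b = a * a - (?it * ?it) *\<^sub>C 1"
        unfolding sb
        by (simp add: algebra_simps scaleC_mult_left scaleC_mult_right scaleC_scaleC
            scaleC_diff_right)
      also have "?it * ?it = complex_of_real (- (t\<^sup>2))"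
        by (simp add: power2_eq_square algebra_simps)
      finally show ?thesis
        by (simp only: scaleC_of_real) simp
    qed
    also have "norm (a * a + (t\<^sup>2) *\<^sub>R 1) \<le> (norm a)\<^sup>2 + t\<^sup>2"
      by (rule norm_triangle_le) (use norm_mult_ineq[of a a] in \<open>simp add: power2_eq_square\<close>)
    finally show ?thesis .
  qed
  have "Im c = 0"
  proof (rule ccontr)
    assume nz: "Im c \<noteq> 0"
    \<comment> \<open>chosen so that the mixed term \<open>2 * Im c * t\<close> alone exceeds \<open>(norm a)\<^sup>2\<close>\<close>
    define t where "t = ((norm a)\<^sup>2 + 1) / (2 * Im c)"
    have "2 * Im c * t = (norm a)\<^sup>2 + 1"
      using nz by (simp add: t_def)
    moreover have "(Im c)\<^sup>2 + 2 * Im c * t \<le> (norm a)\<^sup>2"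
      using ineq[of t] by (simp add: power2_sum)
    ultimately show False
      using zero_le_power2[of "Im c"] by linarith
  qed
  then show ?thesis
    by (simp add: complex_is_Real_iff)
qed

section \<open>Square roots and the norm description of positivity\<close>

text \<open>The element \<open>x + \<i> y\<close> is normal with \<open>(x + \<i> y)\<^sup>* (x + \<i> y) = x\<^sup>2 + y\<^sup>2\<close>, and \<open>x\<close> is
  the mean of \<open>x + \<i> y\<close> and its adjoint. This is the monotonicity of the norm on sums of
  squares, available before any order has been constructed.\<close>

lemma norm_square_le_sum_squares:
  fixes x y :: "'a::cstar_algebra"
  assumes "star x = x" "star y = y" and comm: "x * y = y * x"
  shows "(norm x)\<^sup>2 \<le> norm (x * x + y * y)"
proof -
  let ?z = "x + \<i> *\<^sub>C y"
  have sz: "star ?z = x - \<i> *\<^sub>C y"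
    by (simp add: star_add star_scaleC assms scaleC_minus_left)
  have "2 *\<^sub>R x = ?z + star ?z"
    by (simp add: sz scaleR_2)
  then have "2 * norm x \<le> norm ?z + norm (star ?z)"
    by (metis norm_triangle_ineq norm_scaleR abs_numeral)
  then have "norm x \<le> norm ?z"
    by (simp add: norm_star)
  then have "(norm x)\<^sup>2 \<le> norm (star ?z * ?z)"
    by (simp add: cstar_identity)
  also have "star ?z * ?z = x * x + y * y"
    unfolding sz
    by (simp add: algebra_simps comm scaleC_mult_left scaleC_mult_right scaleC_scaleC
        scaleC_minus_left scaleC_add_right scaleC_diff_right)
  finally show ?thesis .
qed

text \<open>Writing the root of \<open>1 - x\<close> as \<open>1 - y\<close> turns the equation into \<open>y = (x + y\<^sup>2) / 2\<close>, whose
  right-hand side contracts the ball of radius \<open>norm x < 1\<close>. Self-adjointness and membership in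
  the bicommutant of \<open>x\<close> cut out a closed invariant subset, so the fixed point inherits both.\<close>

lemma sqrt_one_minus:
  fixes x :: "'a::cstar_algebra"
  assumes sa: "star x = x" and lt: "norm x < 1"
  obtains s where "star s = s" "s * s = 1 - x" "\<And>z. z * x = x * z \<Longrightarrow> z * s = s * z"
proof -
  define S where "S = cball 0 (norm x) \<inter> {y. star y = y} \<inter> (\<Inter>z\<in>{z. z * x = x * z}. {y. z * y = y * z})"
  define f where "f y = (1/2) *\<^sub>R (x + y * y)" for y
  have cont_star: "continuous_on UNIV (star :: 'a \<Rightarrow> 'a)"
    using bounded_linear_star linear_continuous_on by blast
  have "closed S"
    unfolding S_def
    by (intro closed_Int closed_cball closed_INT ballI closed_Collect_eq continuous_intros cont_star)
  then have comp: "complete S"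
    by (simp add: complete_eq_closed)
  have ne: "S \<noteq> {}"
    using sa by (auto simp: S_def)
  have inv: "f ` S \<subseteq> S"
  proof clarify
    fix y assume y: "y \<in> S"
    then have ny: "norm y \<le> norm x" and sy: "star y = y"
      and cy: "\<And>z. z * x = x * z \<Longrightarrow> z * y = y * z"
      by (auto simp: S_def)
    have "norm (y * y) \<le> norm y * norm y"
      by (rule norm_mult_ineq)
    also have "\<dots> \<le> 1 * norm x"
      using ny lt by (intro mult_mono) auto
    finally have "norm (x + y * y) \<le> 2 * norm x"
      using norm_triangle_ineq[of x "y * y"] by simp
    then have "norm (f y) \<le> norm x"
      by (simp add: f_def)
    moreover have "star (f y) = f y"
      by (simp add: f_def star_scaleR star_add star_mult sa sy)
    moreover have "z * f y = f y * z" if "z * x = x * z" for z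
    proof -
      have "z * (y * y) = (y * y) * z"
        using cy[OF that] by (metis mult.assoc)
      then show ?thesis
        by (simp add: f_def that distrib_left distrib_right)
    qed
    ultimately show "f y \<in> S"
      by (auto simp: S_def)
  qed
  have contr: "dist (f y) (f z) \<le> norm x * dist y z" if "y \<in> S \<and> z \<in> S" for y z
  proof -
    have ny: "norm y \<le> norm x" and nz: "norm z \<le> norm x"
      using that by (auto simp: S_def)
    have "f y - f z = (1/2) *\<^sub>R (y * (y - z) + (y - z) * z)"
      by (simp add: f_def algebra_simps)
    then have "norm (f y - f z) \<le> (1/2) * (norm (y * (y - z)) + norm ((y - z) * z))"
      using norm_triangle_ineq[of "y * (y - z)" "(y - z) * z"] by simp
    also have "\<dots> \<le> (1/2) * (norm x * norm (y - z) + norm (y - z) * norm x)"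
      by (intro mult_left_mono add_mono order_trans[OF norm_mult_ineq] mult_mono)
         (use ny nz in auto)
    finally show ?thesis
      by (simp add: dist_norm algebra_simps)
  qed
  have "\<exists>!y. y \<in> S \<and> f y = y"
    by (rule Banach_fix[OF comp ne norm_ge_zero lt inv]) (use contr in auto)
  then obtain y where y: "y \<in> S" and fy: "f y = y" by blast
  have "x + y * y = 2 *\<^sub>R y"
    using fy unfolding f_def by (metis scaleR_half_double scaleR_2 scaleR_right_distrib)
  then have "(1 - y) * (1 - y) = 1 - x"
    by (simp add: algebra_simps scaleR_2)
  moreover have "star (1 - y) = 1 - y"
    using y by (simp add: S_def star_diff)
  moreover have "z * (1 - y) = (1 - y) * z" if "z * x = x * z" for z
    using y that by (simp add: S_def algebra_simps)
  ultimately show ?thesis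
    using that by blast
qed

lemma sqrt_of_real_minus:
  fixes x :: "'a::cstar_algebra"
  assumes sa: "star x = x" and lt: "norm x < r"
  obtains s where "star s = s" "s * s = of_real r - x" "\<And>z. z * x = x * z \<Longrightarrow> z * s = s * z"
proof -
  have r: "r > 0"
    using lt norm_ge_zero[of x] by linarith
  have "star ((1/r) *\<^sub>R x) = (1/r) *\<^sub>R x"
    by (simp add: star_scaleR sa)
  moreover have "norm ((1/r) *\<^sub>R x) < 1"
    using lt r by simp
  ultimately obtain s where s: "star s = s" "s * s = 1 - (1/r) *\<^sub>R x"
      "\<And>z. z * ((1/r) *\<^sub>R x) = ((1/r) *\<^sub>R x) * z \<Longrightarrow> z * s = s * z"
    by (rule sqrt_one_minus) (rule that)
  show ?thesis
  proof (rule that[of "sqrt r *\<^sub>R s"])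
    show "(sqrt r *\<^sub>R s) * (sqrt r *\<^sub>R s) = of_real r - x"
      using r by (simp add: s(2) algebra_simps of_real_def)
    show "star (sqrt r *\<^sub>R s) = sqrt r *\<^sub>R s"
      by (simp only: star_scaleR s(1))
    show "z * (sqrt r *\<^sub>R s) = (sqrt r *\<^sub>R s) * z" if "z * x = x * z" for z
    proof -
      have "z * s = s * z"
        by (rule s(3)) (simp only: mult_scaleR_left mult_scaleR_right that)
      then show ?thesis
        by (simp only: mult_scaleR_left mult_scaleR_right)
    qed
  qed
qed

text \<open>The norm of a self-adjoint element is attained on its spectrum. If \<open>\<beta>\<^sup>2 - b\<^sup>2\<close> has an
  inverse \<open>d\<close>, then \<open>\<beta>\<^sup>2 - \<kappa> - b\<^sup>2 = (\<beta>\<^sup>2 - b\<^sup>2) (1 - \<kappa> d)\<close> for small \<open>\<kappa>\<close>, and both factors have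
  commuting square roots, the first one after adding \<open>\<eta> > 0\<close>. So \<open>\<beta>\<^sup>2 - \<kappa>\<close> is, up to \<open>\<eta>\<close>,
  a sum of the squares of \<open>b\<close> and of another self-adjoint element, which gives
  \<open>(norm b)\<^sup>2 \<le> \<beta>\<^sup>2 - \<kappa>\<close>.\<close>

lemma norm_selfadjoint_less:
  fixes b :: "'a::cstar_algebra"
  assumes sa: "star b = b" and le: "norm b \<le> \<beta>" and pos: "\<beta> > 0"
    and unit: "unit_element (of_real (\<beta>\<^sup>2) - b * b)"
  shows "norm b < \<beta>"
proof -
  obtain d where d: "(of_real (\<beta>\<^sup>2) - b * b) * d = 1" "d * (of_real (\<beta>\<^sup>2) - b * b) = 1"
    using unit by (auto simp: unit_element_def)
  let ?w = "of_real (\<beta>\<^sup>2) - b * b"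
  have sw: "star ?w = ?w"
    by (simp add: star_diff star_mult sa del: of_real_power)
  have sd: "star d = d"
  proof -
    have "star d * ?w = 1"
      using arg_cong[OF d(1), of star] sw by (simp only: star_mult star_one)
    then show ?thesis
      using d by (metis mult.assoc mult_1_left mult_1_right)
  qed
  have bw: "b * ?w = ?w * b"
    by (simp only: left_diff_distrib right_diff_distrib of_real_mult_commute mult.assoc)
  have bd: "b * d = d * b"
  proof -
    have "b * d = d * (?w * b) * d"
      using d(2) by (metis mult.assoc mult_1_left)
    also have "\<dots> = d * b * (?w * d)"
      by (simp only: bw[symmetric] mult.assoc)
    finally show ?thesis
      using d(1) by simp
  qed
  \<comment> \<open>\<open>\<kappa> * norm d < 1\<close> makes \<open>1 - \<kappa> d\<close> a square; \<open>\<kappa> \<le> \<beta>\<^sup>2\<close> keeps \<open>\<beta>\<^sup>2 - \<kappa>\<close> nonnegative,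
    so that it is its own norm.\<close>
  define \<kappa> where "\<kappa> = min (\<beta>\<^sup>2) (1 / (norm d + 1))"
  have \<kappa>: "\<kappa> > 0" "\<kappa> \<le> \<beta>\<^sup>2"
    using pos by (auto simp: \<kappa>_def add_nonneg_pos)
  have "\<kappa> * norm d \<le> (1 / (norm d + 1)) * norm d"
    by (intro mult_right_mono) (auto simp: \<kappa>_def)
  also have "\<dots> < 1"
    using norm_ge_zero[of d] by (simp add: divide_less_eq add_nonneg_pos)
  finally have \<kappa>d: "norm (\<kappa> *\<^sub>R d) < 1"
    using \<kappa> by simp
  have "star (\<kappa> *\<^sub>R d) = \<kappa> *\<^sub>R d"
    by (simp add: star_scaleR sd)
  then obtain s where s: "star s = s" "s * s = 1 - \<kappa> *\<^sub>R d"
      "\<And>z. z * (\<kappa> *\<^sub>R d) = (\<kappa> *\<^sub>R d) * z \<Longrightarrow> z * s = s * z"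
    using \<kappa>d by (rule sqrt_one_minus) (rule that)
  have bound: "(norm b)\<^sup>2 \<le> (\<beta>\<^sup>2 - \<kappa>) + \<eta> * 2" if \<eta>: "\<eta> > 0" for \<eta>
  proof -
    have "norm b * norm b \<le> \<beta> * \<beta>"
      using le pos by (intro mult_mono) auto
    then have "norm (b * b) \<le> \<beta>\<^sup>2"
      using norm_mult_ineq[of b b] by (simp add: power2_eq_square)
    then have lt: "norm (b * b) < \<beta>\<^sup>2 + \<eta>"
      using \<eta> by simp
    have "star (b * b) = b * b"
      by (simp add: star_mult sa)
    then obtain r where r: "star r = r" "r * r = of_real (\<beta>\<^sup>2 + \<eta>) - b * b"
        "\<And>z. z * (b * b) = (b * b) * z \<Longrightarrow> z * r = r * z"
      using lt by (rule sqrt_of_real_minus) (rule that)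
    have br: "b * r = r * b"
      by (rule r(3)) (simp add: mult.assoc)
    have bs: "b * s = s * b"
      by (rule s(3)) (simp add: bd)
    have "s * (b * b) = (b * b) * s"
      using bs by (metis mult.assoc)
    then have sr: "s * r = r * s"
      by (rule r(3))
    let ?y = "r * s"
    have sy: "star ?y = ?y"
      by (simp add: star_mult r s sr)
    have by_comm: "b * ?y = ?y * b"
      using br bs by (metis mult.assoc)
    have "?y * ?y = (r * r) * (s * s)"
      using sr by (metis mult.assoc)
    also have "\<dots> = (?w + of_real \<eta>) * (1 - \<kappa> *\<^sub>R d)"
      by (simp add: r s algebra_simps)
    also have "\<dots> = ?w - \<kappa> *\<^sub>R (?w * d) + of_real \<eta> * (1 - \<kappa> *\<^sub>R d)"
      by (subst distrib_right) (simp only: right_diff_distrib mult_1_right mult_scaleR_right)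
    also have "\<dots> = ?w - of_real \<kappa> + of_real \<eta> * (1 - \<kappa> *\<^sub>R d)"
      by (simp only: d(1)) (simp add: of_real_def)
    finally have yy: "b * b + ?y * ?y = of_real (\<beta>\<^sup>2 - \<kappa>) + of_real \<eta> * (1 - \<kappa> *\<^sub>R d)"
      by simp
    have "(norm b)\<^sup>2 \<le> norm (b * b + ?y * ?y)"
      by (rule norm_square_le_sum_squares[OF sa sy by_comm])
    also have "\<dots> \<le> norm (of_real (\<beta>\<^sup>2 - \<kappa>) :: 'a) + norm (of_real \<eta> * (1 - \<kappa> *\<^sub>R d))"
      unfolding yy by (rule norm_triangle_ineq)
    also have "\<dots> \<le> (\<beta>\<^sup>2 - \<kappa>) + \<eta> * 2"
    proof (rule add_mono)
      have "norm (1 - \<kappa> *\<^sub>R d) \<le> 2"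
        using norm_triangle_ineq4[of 1 "\<kappa> *\<^sub>R d"] \<kappa>d by simp
      then show "norm (of_real \<eta> * (1 - \<kappa> *\<^sub>R d)) \<le> \<eta> * 2"
        using \<eta> by (simp add: of_real_def)
      show "norm (of_real (\<beta>\<^sup>2 - \<kappa>) :: 'a) \<le> \<beta>\<^sup>2 - \<kappa>"
        using \<kappa> by (simp only: norm_of_real)
    qed
    finally show ?thesis .
  qed
  have "(norm b)\<^sup>2 \<le> (\<beta>\<^sup>2 - \<kappa>)"
  proof (rule field_le_epsilon)
    fix \<epsilon> :: real assume "\<epsilon> > 0"
    then show "(norm b)\<^sup>2 \<le> (\<beta>\<^sup>2 - \<kappa>) + \<epsilon>"
      using bound[of "\<epsilon> / 2"] by simp
  qed
  then have "(norm b)\<^sup>2 < \<beta>\<^sup>2"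
    using \<kappa> by simp
  then show ?thesis
    using pos by (simp add: power_less_imp_less_base)
qed

lemma positive_selfadjoint: "positive a \<Longrightarrow> star a = a"
  by (simp add: positive_def)

lemma positive_if_norm_le:
  fixes a :: "'a::cstar_algebra"
  assumes sa: "star a = a" and le: "norm (of_real t - a) \<le> t"
  shows "positive a"
proof -
  have "c \<in> \<real>\<^sub>\<ge>\<^sub>0" if c: "c \<in> spectrum a" for c
  proof -
    have "c \<in> \<real>"
      using spectrum_selfadjoint_real[OF sa c] .
    then obtain r where r: "c = complex_of_real r"
      by (auto elim: Reals_cases)
    have "(of_real t - a) - (complex_of_real (t - r)) *\<^sub>C 1 = (- 1 *\<^sub>C 1) * (a - c *\<^sub>C 1)"
      by (simp only: r scaleC_of_real_one scaleC_mult_left) (simp add: scaleC_minus_left)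
    moreover have "a - c *\<^sub>C 1 = (- 1 *\<^sub>C 1) * ((- 1 *\<^sub>C 1) * (a - c *\<^sub>C 1))"
      by (simp add: scaleC_mult_left scaleC_minus_left)
    ultimately have "complex_of_real (t - r) \<in> spectrum (of_real t - a)"
      using c unit_element_mult[OF unit_element_scaleC[of "-1"]]
      by (metis not_in_spectrum_iff neg_equal_0_iff_equal zero_neq_one)
    then have "\<bar>t - r\<bar> \<le> t"
      using spectrum_norm_le le by (metis norm_of_real order_trans)
    then show ?thesis
      by (simp add: r)
  qed
  then show ?thesis
    by (auto simp: positive_def sa)
qed

text \<open>The spectrum of \<open>b = t - a\<close> lies in \<open>(-\<infinity>, t]\<close> because \<open>a\<close> is positive, and in
  \<open>[0, \<infinity>)\<close> because \<open>spectrum a\<close> is bounded by \<open>norm a \<le> t\<close>. So it contains neither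
  \<open>norm b\<close> nor \<open>- norm b\<close> if \<open>norm b > t\<close>; but one of them is a spectral value.\<close>

lemma positive_norm_le:
  fixes a :: "'a::cstar_algebra"
  assumes pos: "positive a" and t: "norm a \<le> t"
  shows "norm (of_real t - a) \<le> t"
proof (rule ccontr)
  let ?b = "of_real t - a"
  let ?\<beta> = "norm ?b"
  assume "\<not> ?\<beta> \<le> t"
  then have gt: "?\<beta> > t" by simp
  have t0: "t \<ge> 0"
    using t norm_ge_zero[of a] by linarith
  have sa: "star ?b = ?b"
    using pos by (simp add: star_diff positive_selfadjoint)
  have "complex_of_real (t - ?\<beta>) \<notin> spectrum a"
    using pos gt unfolding positive_def by (auto simp: subset_iff simp del: of_real_diff)
  then have 1: "unit_element (a - of_real (t - ?\<beta>))"
    by (simp only: not_in_spectrum_iff scaleC_of_real_one not_not)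
  have "complex_of_real (t + ?\<beta>) \<notin> spectrum a"
  proof
    assume "complex_of_real (t + ?\<beta>) \<in> spectrum a"
    from spectrum_norm_le[OF this] have "\<bar>t + ?\<beta>\<bar> \<le> norm a"
      by (simp only: norm_of_real)
    then show False
      using t t0 gt by linarith
  qed
  then have 2: "unit_element (a - of_real (t + ?\<beta>))"
    by (simp only: not_in_spectrum_iff scaleC_of_real_one not_not)
  have "unit_element ((- 1 *\<^sub>C 1) * ((a - of_real (t - ?\<beta>)) * (a - of_real (t + ?\<beta>))))"
    by (intro unit_element_mult 1 2) (use unit_element_scaleC[of "-1"] in simp)
  also have "(- 1 *\<^sub>C 1) * ((a - of_real (t - ?\<beta>)) * (a - of_real (t + ?\<beta>)))
      = - ((?b - of_real ?\<beta>) * (?b + of_real ?\<beta>))"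
    by (simp add: scaleC_minus_left scaleC_mult_left algebra_simps)
  also have "\<dots> = of_real (?\<beta>\<^sup>2) - ?b * ?b"
    by (simp only: distrib_left left_diff_distrib of_real_mult_commute[of ?\<beta> ?b])
       (simp add: power2_eq_square)
  finally have "unit_element (of_real (?\<beta>\<^sup>2) - ?b * ?b)" .
  moreover have "?\<beta> > 0"
    using gt t0 by linarith
  ultimately have "?\<beta> < ?\<beta>"
    using norm_selfadjoint_less[OF sa order_refl] by blast
  then show False by simp
qed

section \<open>The cone of positive elements\<close>

lemma positive_add:
  fixes a b :: "'a::cstar_algebra"
  assumes "positive a" "positive b"
  shows "positive (a + b)"
proof (rule positive_if_norm_le)
  show "star (a + b) = a + b"
    using assms by (simp add: star_add positive_selfadjoint)
  have "norm ((of_real (norm a) - a) + (of_real (norm b) - b)) \<le> norm a + norm b"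
    using assms by (intro norm_triangle_mono positive_norm_le) auto
  then show "norm (of_real (norm a + norm b) - (a + b)) \<le> norm a + norm b"
    by (simp add: algebra_simps)
qed

lemma positive_of_real: "r \<ge> 0 \<Longrightarrow> positive (of_real r :: 'a::cstar_algebra)"
  by (rule positive_if_norm_le[where t=r]) auto

text \<open>The bound \<open>norm (t - a) \<le> t\<close> characterises positivity once \<open>t \<ge> norm a\<close>, and a single
  \<open>t\<close> serves all \<open>a + \<epsilon> y\<close> with \<open>\<epsilon> \<le> 1\<close>, so the bound passes to the limit.\<close>

lemma positive_limit:
  fixes a y :: "'a::cstar_algebra"
  assumes pos: "\<And>\<epsilon>::real. \<epsilon> > 0 \<Longrightarrow> positive (a + \<epsilon> *\<^sub>R y)"
  shows "positive a"
proof (rule positive_if_norm_le)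
  have eq: "star a + star y = a + y" "star a + 2 *\<^sub>R star y = a + 2 *\<^sub>R y"
    using positive_selfadjoint[OF pos[of 1]] positive_selfadjoint[OF pos[of 2]]
    by (simp_all add: star_add star_scaleR)
  have "star a = 2 *\<^sub>R (star a + star y) - (star a + 2 *\<^sub>R star y)"
    by (simp add: scaleR_2)
  also have "\<dots> = a"
    unfolding eq by (simp add: scaleR_2)
  finally show "star a = a" .
  let ?t = "norm a + norm y"
  show "norm (of_real ?t - a) \<le> ?t"
  proof (rule field_le_epsilon)
    fix e :: real assume e: "e > 0"
    define \<epsilon> where "\<epsilon> = min 1 (e / (norm y + 1))"
    have \<epsilon>: "\<epsilon> > 0" "\<epsilon> \<le> 1"
      using e by (auto simp: \<epsilon>_def add_nonneg_pos)
    have "\<epsilon> * norm y \<le> (e / (norm y + 1)) * norm y"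
      by (intro mult_right_mono) (auto simp: \<epsilon>_def)
    also have "\<dots> \<le> e"
      using e norm_ge_zero[of y] by (simp add: divide_le_eq add_nonneg_pos)
    finally have \<epsilon>y: "\<epsilon> * norm y \<le> e" .
    have "\<epsilon> * norm y \<le> 1 * norm y"
      using \<epsilon> by (intro mult_right_mono) auto
    then have "norm (a + \<epsilon> *\<^sub>R y) \<le> ?t"
      using norm_triangle_ineq[of a "\<epsilon> *\<^sub>R y"] \<epsilon> by simp
    then have "norm (of_real ?t - (a + \<epsilon> *\<^sub>R y)) \<le> ?t"
      using positive_norm_le pos \<epsilon> by blast
    then have "norm ((of_real ?t - (a + \<epsilon> *\<^sub>R y)) + \<epsilon> *\<^sub>R y) \<le> ?t + e"
      using \<epsilon>y \<epsilon> by (intro norm_triangle_mono) auto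
    then show "norm (of_real ?t - a) \<le> ?t + e"
      by simp
  qed
qed

text \<open>For \<open>c\<close> outside \<open>[0, \<infinity>)\<close> both roots \<open>\<plusminus> csqrt c\<close> are non-real, and
  \<open>s\<^sup>2 - c = (s - csqrt c) (s + csqrt c)\<close>.\<close>

lemma positive_square:
  fixes s :: "'a::cstar_algebra"
  assumes sa: "star s = s"
  shows "positive (s * s)"
proof -
  have "c \<in> \<real>\<^sub>\<ge>\<^sub>0" if c: "c \<in> spectrum (s * s)" for c
  proof (rule ccontr)
    assume nn: "c \<notin> \<real>\<^sub>\<ge>\<^sub>0"
    let ?m = "csqrt c"
    have "?m \<notin> \<real>"
    proof
      assume "?m \<in> \<real>"
      then obtain r where "?m = complex_of_real r"
        by (auto elim: Reals_cases)
      then have "c = complex_of_real (r\<^sup>2)"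
        by (metis of_real_power power2_csqrt)
      then show False
        using nn by (simp del: of_real_power)
    qed
    then have "?m \<notin> spectrum s" "- ?m \<notin> spectrum s"
      using spectrum_selfadjoint_real[OF sa] Reals_minus_iff by blast+
    then have "unit_element ((s - ?m *\<^sub>C 1) * (s - (- ?m) *\<^sub>C 1))"
      by (simp only: not_in_spectrum_iff unit_element_mult)
    also have "(s - ?m *\<^sub>C 1) * (s - (- ?m) *\<^sub>C 1) = s * s - (?m * ?m) *\<^sub>C 1"
      by (simp add: algebra_simps scaleC_mult_left scaleC_mult_right scaleC_scaleC
          scaleC_minus_left scaleC_diff_right)
    also have "?m * ?m = c"
      by (metis power2_csqrt power2_eq_square)
    finally show False
      using c not_in_spectrum_iff by blast
  qed
  then show ?thesis
    by (auto simp: positive_def star_mult sa)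
qed

lemma positive_sqrt:
  fixes a :: "'a::cstar_algebra"
  assumes pos: "positive a" and \<epsilon>: "\<epsilon> > 0"
  obtains s where "star s = s" "s * s = a + of_real \<epsilon>" "\<And>z. z * a = a * z \<Longrightarrow> z * s = s * z"
proof -
  let ?x = "of_real (norm a) - a"
  have "star ?x = ?x"
    using pos by (simp add: star_diff positive_selfadjoint)
  moreover have "norm ?x < norm a + \<epsilon>"
    using positive_norm_le[OF pos order_refl] \<epsilon> by simp
  ultimately obtain s where s: "star s = s" "s * s = of_real (norm a + \<epsilon>) - ?x"
      "\<And>z. z * ?x = ?x * z \<Longrightarrow> z * s = s * z"
    by (rule sqrt_of_real_minus) (rule that)
  show ?thesis
  proof (rule that[of s])
    show "s * s = a + of_real \<epsilon>"
      by (simp add: s(2))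
    show "z * s = s * z" if "z * a = a * z" for z
      by (rule s(3)) (simp only: left_diff_distrib right_diff_distrib of_real_mult_commute that)
  qed (rule s)
qed

text \<open>After adding \<open>\<epsilon>\<close> and \<open>\<delta>\<close> to the factors, the product is the square of the product of
  their commuting square roots.\<close>

lemma positive_mult_commuting:
  fixes a b :: "'a::cstar_algebra"
  assumes a: "positive a" and b: "positive b" and comm: "a * b = b * a"
  shows "positive (a * b)"
proof (rule positive_limit)
  fix \<epsilon> :: real assume \<epsilon>: "\<epsilon> > 0"
  have "positive ((a + of_real \<epsilon>) * b)"
  proof (rule positive_limit)
    fix \<delta> :: real assume \<delta>: "\<delta> > 0"
    obtain s where s: "star s = s" "s * s = a + of_real \<epsilon>" "\<And>z. z * a = a * z \<Longrightarrow> z * s = s * z"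
      using a \<epsilon> by (rule positive_sqrt) (rule that)
    obtain r where r: "star r = r" "r * r = b + of_real \<delta>" "\<And>z. z * b = b * z \<Longrightarrow> z * r = r * z"
      using b \<delta> by (rule positive_sqrt) (rule that)
    have sr: "s * r = r * s"
      using r(3) s(3) comm by metis
    have "positive ((s * r) * (s * r))"
      by (rule positive_square) (simp add: star_mult s r sr)
    also have "(s * r) * (s * r) = (s * s) * (r * r)"
      using sr by (metis mult.assoc)
    also have "\<dots> = (a + of_real \<epsilon>) * b + \<delta> *\<^sub>R (a + of_real \<epsilon>)"
      by (simp only: s r distrib_left) (simp add: of_real_def)
    finally show "positive ((a + of_real \<epsilon>) * b + \<delta> *\<^sub>R (a + of_real \<epsilon>))" .
  qed
  then show "positive (a * b + \<epsilon> *\<^sub>R b)"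
    by (simp add: distrib_right of_real_def)
qed

lemma positive_of_real_mult:
  fixes a :: "'a::cstar_algebra"
  assumes "r \<ge> 0" "positive a"
  shows "positive (of_real r * a)"
  by (rule positive_mult_commuting[OF positive_of_real[OF assms(1)] assms(2) of_real_mult_commute])

section \<open>The centre\<close>

definition central :: "'a::times \<Rightarrow> bool" where
  "central z \<longleftrightarrow> (\<forall>w. z * w = w * z)"

lemma central_commute: "central z \<Longrightarrow> w * z = z * w"
  by (simp add: central_def)

lemma central_mult:
  fixes z :: "'a::semigroup_mult"
  shows "central z \<Longrightarrow> central w \<Longrightarrow> central (z * w)"
  unfolding central_def by (metis mult.assoc)

lemma central_add:
  fixes z :: "'a::semiring"
  shows "central z \<Longrightarrow> central w \<Longrightarrow> central (z + w)"
  by (simp add: central_def algebra_simps)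

lemma central_minus:
  fixes z :: "'a::ring"
  shows "central z \<Longrightarrow> central (- z)"
  by (simp add: central_def)

lemma central_diff:
  fixes z :: "'a::ring"
  shows "central z \<Longrightarrow> central w \<Longrightarrow> central (z - w)"
  by (simp add: central_def algebra_simps)

lemma central_of_real: "central (of_real r :: 'a::real_algebra_1)"
  by (simp add: central_def of_real_mult_commute)

lemma central_zero: "central (0::'a::mult_zero)"
  by (simp add: central_def)

lemma central_one: "central (1::'a::monoid_mult)"
  by (simp add: central_def)

lemma central_sum:
  fixes f :: "'i \<Rightarrow> 'a::semiring_0"
  shows "(\<And>i. i \<in> I \<Longrightarrow> central (f i)) \<Longrightarrow> central (sum f I)"
  by (induction I rule: infinite_finite_induct) (auto simp: central_zero central_add)

lemma central_star: "central z \<Longrightarrow> central (star (z::'a::cstar_algebra))"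
  unfolding central_def by (metis star_mult star_star)

lemma central_inverse:
  fixes z :: "'a::monoid_mult"
  assumes "central z" "z * c = 1" "c * z = 1"
  shows "central c"
  unfolding central_def
proof
  fix w
  have "c * w = c * (w * z) * c"
    using assms(2) by (simp add: mult.assoc)
  also have "\<dots> = (c * z) * (w * c)"
    using assms(1) by (simp add: central_def mult.assoc)
  finally show "c * w = w * c"
    using assms(3) by simp
qed

text \<open>A central element is normal, which makes this elementary: four times the product is the sum of the squares of
  the self-adjoint elements \<open>z + z\<^sup>*\<close> and \<open>\<i> (z - z\<^sup>*)\<close>.\<close>

lemma positive_central_mult_star:
  fixes z :: "'a::cstar_algebra"
  assumes z: "central z"
  shows "positive (z * star z)"
proof -
  let ?h = "z + star z" and ?k = "\<i> *\<^sub>C (z - star z)"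
  have "star ?h = ?h" "star ?k = ?k"
    by (simp_all add: star_add star_diff star_scaleC star_star scaleC_minus_left scaleC_diff_right)
  then have "positive (?h * ?h + ?k * ?k)"
    by (intro positive_add positive_square)
  also have "?h * ?h + ?k * ?k = z * star z + z * star z + z * star z + z * star z"
    using central_commute[OF z, of "star z"]
    by (simp add: scaleC_mult_left scaleC_mult_right scaleC_scaleC scaleC_minus_left
        scaleC_diff_right algebra_simps)
  also have "\<dots> = of_real 4 * (z * star z)"
    by (simp only: numeral_Bit0 numeral_One of_real_add of_real_1 distrib_right mult_1_left
        add.assoc)
  finally have "positive (of_real (1/4) * (of_real 4 * (z * star z)))"
    by (rule positive_of_real_mult[rotated]) simp
  then show ?thesis
    by (simp add: of_real_def)
qed

lemma positive_add_of_real_inverse: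
  fixes a :: "'a::cstar_algebra"
  assumes pos: "positive a" and \<epsilon>: "\<epsilon> > 0"
  obtains c where "(a + of_real \<epsilon>) * c = 1" "c * (a + of_real \<epsilon>) = 1" "positive c"
proof -
  have "complex_of_real (- \<epsilon>) \<notin> spectrum a"
    using pos \<epsilon> unfolding positive_def by (auto simp: subset_iff simp del: of_real_minus)
  then have "unit_element (a - of_real (- \<epsilon>))"
    by (simp only: not_in_spectrum_iff scaleC_of_real_one not_not)
  then obtain c where c: "(a + of_real \<epsilon>) * c = 1" "c * (a + of_real \<epsilon>) = 1"
    by (auto simp: unit_element_def)
  have p: "positive (a + of_real \<epsilon>)"
    using pos \<epsilon> by (intro positive_add positive_of_real) auto
  have "star c * (a + of_real \<epsilon>) = 1"
    using arg_cong[OF c(1), of star] positive_selfadjoint[OF p] by (simp only: star_mult star_one)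
  then have sc: "star c = c"
    using c by (metis mult.assoc mult_1_left mult_1_right)
  have "positive ((c * c) * (a + of_real \<epsilon>))"
    using positive_square[OF sc] p
    by (rule positive_mult_commuting) (metis c mult.assoc mult_1_left mult_1_right)
  also have "(c * c) * (a + of_real \<epsilon>) = c"
    by (simp only: mult.assoc c(2) mult_1_right)
  finally show ?thesis
    using that c by blast
qed

section \<open>The Schur product of two forms\<close>

text \<open>With \<open>x\<^sub>k\<close> and \<open>x\<^sub>j\<^sup>*\<close> both to the right of the coefficient, as the inner product
  \<open>\<Sum>j. x\<^sub>j y\<^sub>j\<^sup>*\<close> dictates.\<close>

definition hform :: "'i set \<Rightarrow> ('i \<Rightarrow> 'i \<Rightarrow> 'a::cstar_algebra) \<Rightarrow> ('i \<Rightarrow> 'a) \<Rightarrow> 'a" where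
  "hform I m x = (\<Sum>j\<in>I. \<Sum>k\<in>I. m j k * (x k * star (x j)))"

lemma hform_cong:
  assumes "\<And>j k. j \<in> I \<Longrightarrow> k \<in> I \<Longrightarrow> m j k * (x k * star (x j)) = m' j k * (x' k * star (x' j))"
  shows "hform I m x = hform I m' x'"
  unfolding hform_def using assms by (intro sum.cong refl)

lemma hform_insert:
  assumes "finite I" "i \<notin> I"
  shows "hform (insert i I) m x =
     m i i * (x i * star (x i)) + (\<Sum>k\<in>I. m i k * (x k * star (x i)))
     + (\<Sum>j\<in>I. m j i * (x i * star (x j))) + hform I m x"
  using assms by (simp add: hform_def sum.distrib add.assoc)

lemma hform_insert_zero:
  assumes "finite I" "i \<notin> I"
  shows "hform (insert i I) m (x(i := 0)) = hform I m x"
proof -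
  have "hform I m (x(i := 0)) = hform I m x"
    using assms by (intro hform_cong) auto
  then show ?thesis
    using assms by (simp add: hform_insert)
qed

lemma central_rearrange:
  fixes a b c n x y :: "'a::cstar_algebra"
  assumes "central a" "central b"
  shows "c * (n * ((a * x) * star (b * y))) = ((star b * c * a) * n) * (x * star y)"
proof -
  have b: "central (star b)"
    using assms(2) by (rule central_star)
  have "c * (n * ((a * x) * star (b * y))) = c * (n * (a * (x * star y))) * star b"
    by (simp only: star_mult mult.assoc)
  also have "\<dots> = star b * (c * (n * (a * (x * star y))))"
    by (rule central_commute[OF b])
  also have "\<dots> = star b * c * (n * a) * (x * star y)"
    by (simp only: mult.assoc)
  also have "\<dots> = star b * c * (a * n) * (x * star y)"
    by (simp only: central_commute[OF assms(1), of n])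
  also have "\<dots> = ((star b * c * a) * n) * (x * star y)"
    by (simp only: mult.assoc)
  finally show ?thesis .
qed

text \<open>Completing the square: evaluating the form at \<open>x\<^sub>i = - c q\<close>, where \<open>q = \<Sum>k. m\<^sub>i\<^sub>k x\<^sub>k\<close> and
  \<open>c\<close> is the inverse of \<open>m\<^sub>i\<^sub>i + \<epsilon>\<close>, yields the Schur complement up to the term
  \<open>\<epsilon> (c q) (c q)\<^sup>*\<close>, which is positive because \<open>c q\<close> is central.\<close>

lemma schur_complement_positive:
  fixes m :: "'i \<Rightarrow> 'i \<Rightarrow> 'a::cstar_algebra"
  assumes I: "finite I" "i \<notin> I"
    and cm: "\<And>j k. central (m j k)" and herm: "\<And>j k. star (m j k) = m k j"
    and pos: "\<And>x. (\<And>k. central (x k)) \<Longrightarrow> positive (hform (insert i I) m x)"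
    and \<epsilon>: "\<epsilon> > 0" and c: "(m i i + of_real \<epsilon>) * c = 1" and sc: "star c = c" and cc: "central c"
    and cx: "\<And>k. central (x k)"
  shows "positive (hform I (\<lambda>j k. m j k - m j i * c * m i k) x)"
proof -
  define q where "q = (\<Sum>k\<in>I. m i k * x k)"
  have cq: "central q"
    unfolding q_def by (intro central_sum central_mult cm cx)
  have sq: "star q = (\<Sum>j\<in>I. m j i * star (x j))"
    by (simp add: q_def star_sum star_mult herm central_commute[OF cm])
  have ccq: "central (c * q)"
    using cc cq by (rule central_mult)
  have scq: "star (c * q) = c * star q"
    by (simp add: star_mult sc central_commute[OF cc])
  define x' where "x' = x(i := - (c * q))"
  have cx': "central (x' k)" for k
    using cx ccq by (simp add: x'_def central_minus)
  have mc: "m i i * c = 1 - \<epsilon> *\<^sub>R c"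
    using c by (simp add: algebra_simps of_real_def)
  let ?P = "c * (q * star q)"
  have t1: "m i i * ((c * q) * (c * star q)) = ?P - \<epsilon> *\<^sub>R ((c * q) * (c * star q))"
  proof -
    have "m i i * ((c * q) * (c * star q)) = (m i i * c) * (q * (c * star q))"
      by (simp add: mult.assoc)
    also have "\<dots> = q * (c * star q) - \<epsilon> *\<^sub>R ((c * q) * (c * star q))"
      by (simp add: mc left_diff_distrib mult.assoc)
    also have "q * (c * star q) = ?P"
      by (metis central_commute[OF cc] mult.assoc)
    finally show ?thesis .
  qed
  have t2: "(\<Sum>k\<in>I. m i k * (x' k * star (x' i))) = - ?P"
  proof -
    have "(\<Sum>k\<in>I. m i k * (x' k * star (x' i))) = (\<Sum>k\<in>I. (m i k * x k) * (- (c * star q)))"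
      using I by (intro sum.cong) (auto simp: x'_def star_minus scq mult.assoc)
    also have "\<dots> = q * (- (c * star q))"
      by (simp only: q_def sum_distrib_right)
    also have "\<dots> = - ?P"
      by (metis central_commute[OF cc] mult.assoc mult_minus_right)
    finally show ?thesis .
  qed
  have t3: "(\<Sum>j\<in>I. m j i * (x' i * star (x' j))) = - ?P"
  proof -
    have "(\<Sum>j\<in>I. m j i * (x' i * star (x' j))) = (\<Sum>j\<in>I. (- (c * q)) * (m j i * star (x j)))"
    proof (rule sum.cong[OF refl])
      fix j assume "j \<in> I"
      then have "x' j = x j" "x' i = - (c * q)"
        using I by (auto simp: x'_def)
      then show "m j i * (x' i * star (x' j)) = (- (c * q)) * (m j i * star (x j))"
        by (metis central_commute[OF cm] mult.assoc)
    qed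
    also have "\<dots> = (- (c * q)) * star q"
      by (simp only: sq sum_distrib_left)
    finally show ?thesis
      by (simp add: mult.assoc)
  qed
  have t4: "hform I m x' = hform I m x"
    using I by (intro hform_cong) (auto simp: x'_def)
  have "hform (insert i I) m x' =
      ?P - \<epsilon> *\<^sub>R ((c * q) * (c * star q)) + (- ?P) + (- ?P) + hform I m x"
    unfolding hform_insert[OF I] t2 t3 t4 t1[symmetric]
    by (simp add: x'_def star_minus scq)
  then have eq: "hform I m x - ?P = hform (insert i I) m x' + of_real \<epsilon> * ((c * q) * star (c * q))"
    by (simp add: scq of_real_def)
  have "hform I (\<lambda>j k. m j k - m j i * c * m i k) x
      = hform I m x - (\<Sum>j\<in>I. \<Sum>k\<in>I. (m j i * c * m i k) * (x k * star (x j)))"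
    by (simp add: hform_def left_diff_distrib sum_subtractf)
  also have "(\<Sum>j\<in>I. \<Sum>k\<in>I. (m j i * c * m i k) * (x k * star (x j)))
      = (\<Sum>j\<in>I. \<Sum>k\<in>I. c * ((m i k * x k) * (m j i * star (x j))))"
  proof (intro sum.cong refl)
    fix j k
    have "(m j i * c * m i k) * (x k * star (x j)) = m j i * (c * m i k * (x k * star (x j)))"
      by (simp only: mult.assoc)
    also have "\<dots> = (c * m i k * (x k * star (x j))) * m j i"
      by (rule central_commute[OF cm, symmetric])
    also have "\<dots> = c * ((m i k * x k) * (star (x j) * m j i))"
      by (simp only: mult.assoc)
    also have "star (x j) * m j i = m j i * star (x j)"
      by (rule central_commute[OF cm])
    finally show "(m j i * c * m i k) * (x k * star (x j))
        = c * ((m i k * x k) * (m j i * star (x j)))" .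
  qed
  also have "\<dots> = c * (\<Sum>j\<in>I. \<Sum>k\<in>I. (m i k * x k) * (m j i * star (x j)))"
    by (simp only: sum_distrib_left)
  also have "(\<Sum>j\<in>I. \<Sum>k\<in>I. (m i k * x k) * (m j i * star (x j))) = q * star q"
    unfolding sq unfolding q_def sum_product by (rule sum.swap)
  finally have "hform I (\<lambda>j k. m j k - m j i * c * m i k) x
      = hform (insert i I) m x' + of_real \<epsilon> * ((c * q) * star (c * q))"
    by (simp only: eq)
  moreover have "positive (of_real \<epsilon> * ((c * q) * star (c * q)))"
    using \<epsilon> by (intro positive_of_real_mult positive_central_mult_star ccq) simp
  moreover have "positive (hform (insert i I) m x')"
    using cx' by (rule pos)
  ultimately show ?thesis
    by (simp add: positive_add)
qed

text \<open>Induction on the index set by elimination of one index \<open>i\<close>. Adding \<open>\<epsilon>\<close> to the entry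
  \<open>m\<^sub>i\<^sub>i\<close> makes it invertible with inverse \<open>c\<close>. The modified matrix is the sum of its Schur
  complement, which lives on \<open>I\<close>, and of the rank-one matrix with entries \<open>v\<^sub>j\<^sup>* c v\<^sub>k\<close>, where \<open>v\<close>
  is its row \<open>i\<close>. The form of the Schur product of this rank-one part with \<open>n\<close>, evaluated at
  \<open>x\<close>, is \<open>c\<close> times the form of \<open>n\<close> at the vector \<open>(v\<^sub>k x\<^sub>k)\<^sub>k\<close>; the induction hypothesis covers
  the Schur complement, and \<open>\<epsilon>\<close> tends to \<open>0\<close> at the end. Positivity of \<open>m\<close> is required for central vectors only: this class is
  preserved by Schur complements, and inside the centre \<open>z z\<^sup>*\<close> is evidently positive.\<close>

lemma schur_product_form_positive:
  fixes m n :: "'i \<Rightarrow> 'i \<Rightarrow> 'a::cstar_algebra"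
  assumes "finite I"
    and "\<And>j k. central (m j k)" and "\<And>j k. star (m j k) = m k j"
    and "\<And>x. (\<And>k. central (x k)) \<Longrightarrow> positive (hform I m x)"
    and "\<And>x. positive (hform I n x)"
  shows "positive (hform I (\<lambda>j k. m j k * n j k) x)"
  using assms
proof (induction I arbitrary: m x rule: finite_induct)
  case empty
  show ?case
    using positive_of_real[of 0] by (simp add: hform_def)
next
  case (insert i I)
  note I = insert.hyps and IH = insert.IH
    and cm = insert.prems(1) and herm = insert.prems(2)
    and mpos = insert.prems(3) and npos = insert.prems(4)
  \<comment> \<open>the diagonal entry \<open>m\<^sub>i\<^sub>i\<close> is the value of the form at a unit vector\<close>
  define e where "e = (\<lambda>k. if k = i then 1 else 0 :: 'a)"
  have "e k = 0" if "k \<in> I" for k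
    using that I by (auto simp: e_def)
  moreover have "e i = 1"
    by (simp add: e_def)
  ultimately have "hform (insert i I) m e = m i i"
    by (simp add: hform_insert I hform_def cong: sum.cong)
  moreover have "central (e k)" for k
    by (simp add: e_def central_zero central_one)
  ultimately have mii: "positive (m i i)"
    using mpos by metis
  have "positive (hform (insert i I) (\<lambda>j k. m j k * n j k) x + \<epsilon> *\<^sub>R (n i i * (x i * star (x i))))"
    if \<epsilon>: "\<epsilon> > 0" for \<epsilon>
  proof -
    let ?p = "m i i + of_real \<epsilon>"
    obtain c where c: "?p * c = 1" "c * ?p = 1" and pc: "positive c"
      using mii \<epsilon> by (rule positive_add_of_real_inverse) (rule that)
    have cp: "central ?p"
      by (intro central_add cm central_of_real)
    have cc: "central c"
      using cp c by (rule central_inverse)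
    have sc: "star c = c"
      using pc by (rule positive_selfadjoint)
    have sp: "star ?p = ?p"
      by (simp add: star_add herm)
    let ?S = "\<lambda>j k. m j k - m j i * c * m i k"
    have schur: "positive (hform I (\<lambda>j k. ?S j k * n j k) x)"
    proof (rule IH)
      show "central (?S j k)" for j k
        by (intro central_diff central_mult cm cc)
      show "star (?S j k) = ?S k j" for j k
        by (simp add: star_diff star_mult herm sc mult.assoc)
      show "positive (hform I ?S y)" if "\<And>k. central (y k)" for y
        by (rule schur_complement_positive[OF I cm herm mpos \<epsilon> c(1) sc cc that])
      show "positive (hform I n y)" for y
        using npos[of "y(i := 0)"] by (simp only: hform_insert_zero[OF I])
    qed
    define v where "v k = (if k = i then ?p else m i k)" for k
    define y where "y k = v k * x k" for k
    have cv: "central (v k)" for k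
      using cm cp by (simp add: v_def)
    have rank_one: "positive (c * hform (insert i I) n y)"
      using pc npos by (rule positive_mult_commuting) (use cc in \<open>simp add: central_def\<close>)
    have "hform I (\<lambda>j k. ?S j k * n j k) x + c * hform (insert i I) n y
        = hform (insert i I) (\<lambda>j k. m j k * n j k) x + \<epsilon> *\<^sub>R (n i i * (x i * star (x i)))"
    proof -
      have "c * hform (insert i I) n y = hform (insert i I) (\<lambda>j k. (star (v j) * c * v k) * n j k) x"
        unfolding hform_def sum_distrib_left y_def
        by (intro sum.cong refl central_rearrange cv)
      also have "\<dots> = (?p * n i i) * (x i * star (x i))
          + (\<Sum>k\<in>I. (m i k * n i k) * (x k * star (x i)))
          + (\<Sum>j\<in>I. (m j i * n j i) * (x i * star (x j)))
          + hform I (\<lambda>j k. (m j i * c * m i k) * n j k) x"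
      proof -
        have "star (v i) * c * v i = ?p"
          by (simp add: v_def sp c)
        moreover have "star (v i) * c * v k = m i k" if "k \<in> I" for k
          using that I by (auto simp: v_def sp c)
        moreover have "star (v j) * c * v i = m j i" if "j \<in> I" for j
          using that I c by (auto simp: v_def herm mult.assoc)
        moreover have "star (v j) * c * v k = m j i * c * m i k" if "j \<in> I" "k \<in> I" for j k
          using that I by (auto simp: v_def herm)
        ultimately show ?thesis
          unfolding hform_insert[OF I] by (simp add: hform_def)
      qed
      finally show ?thesis
        by (simp add: hform_insert[OF I])
           (simp add: hform_def left_diff_distrib distrib_right sum_subtractf of_real_def)
    qed
    then show ?thesis
      using positive_add[OF schur rank_one] by (simp only:)
  qed
  then show ?case
    by (rule positive_limit)
qed

section \<open>Positive matrices\<close>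

lemma cstar_inner_eq_hform:
  "cstar_inner (M *v x) x = hform UNIV (\<lambda>j k. M $ j $ k) (\<lambda>k. x $ k)"
  by (simp add: cstar_inner_def hform_def matrix_vector_mult_def sum_distrib_right mult.assoc)

lemma cstar_inner_axis:
  "cstar_inner (M *v axis k a) (axis j b) = M $ j $ k * (a * star b)"
proof -
  have 1: "(M *v axis k a) $ l = M $ l $ k * a" for l
    by (simp add: matrix_vector_mult_def axis_def if_distrib[of "\<lambda>y. _ * y"] cong: if_cong)
  have "cstar_inner (M *v axis k a) (axis j b)
      = (\<Sum>l\<in>UNIV. if l = j then M $ l $ k * a * star b else 0)"
    unfolding cstar_inner_def 1 by (intro sum.cong) (auto simp: axis_def)
  then show ?thesis
    by (simp add: mult.assoc)
qed

lemma matrix_positive_hermitian: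
  assumes "matrix_positive M"
  shows "star (M $ j $ k) = M $ k $ j"
proof -
  have "M = matrix_star M"
    using assms by (simp add: matrix_positive_def)
  then have "M $ k $ j = matrix_star M $ k $ j"
    by simp
  then show ?thesis
    by (simp add: matrix_star_def)
qed

text \<open>All values \<open>\<langle>M x, x\<rangle>\<close> are self-adjoint, hence so is \<open>\<langle>M x, y\<rangle> + \<langle>M y, x\<rangle>\<close>. For
  \<open>x = a e\<^sub>k\<close> and \<open>y = e\<^sub>j\<close> this element is \<open>m a + m\<^sup>* a\<^sup>*\<close> with \<open>m = m\<^sub>j\<^sub>k\<close>, so
  \<open>m a + m\<^sup>* a\<^sup>* = a\<^sup>* m\<^sup>* + a m\<close>. Comparing this with the same identity for \<open>\<i> a\<close> gives
  \<open>m a = a m\<close>. The coefficient stands to the left of \<open>x\<^sub>k x\<^sub>j\<^sup>*\<close> rather than between the two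
  factors, and this is where that matters.\<close>

lemma matrix_positive_entry_central:
  fixes M :: "'a::cstar_algebra ^ 'n ^ 'n"
  assumes pos: "matrix_positive M"
  shows "central (M $ j $ k)"
  unfolding central_def
proof
  fix a
  let ?m = "M $ j $ k"
  have form: "star (cstar_inner (M *v x) x) = cstar_inner (M *v x) x" for x
    using pos by (simp add: matrix_positive_def positive_selfadjoint)
  have sym: "?m * b + star ?m * star b = star b * star ?m + b * ?m" for b
  proof -
    let ?x = "axis k b" and ?y = "axis j 1 :: 'a ^ 'n"
    have add: "cstar_inner (u + v) w = cstar_inner u w + cstar_inner v w"
      "cstar_inner w (u + v) = cstar_inner w u + cstar_inner w v" for u v w :: "'a ^ 'n"
      by (simp_all add: cstar_inner_def sum.distrib star_add algebra_simps)
    let ?s = "cstar_inner (M *v ?x) ?y + cstar_inner (M *v ?y) ?x"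
    have "cstar_inner (M *v (?x + ?y)) (?x + ?y)
        = cstar_inner (M *v ?x) ?x + cstar_inner (M *v ?y) ?y + ?s"
      by (simp add: matrix_vector_right_distrib add)
    then have "star ?s = ?s"
      using form[of "?x + ?y"] form[of ?x] form[of ?y] by (simp add: star_add)
    then have "star (?m * b + star ?m * star b) = ?m * b + star ?m * star b"
      by (simp add: cstar_inner_axis matrix_positive_hermitian[OF pos])
    then show ?thesis
      by (simp add: star_add star_mult star_star)
  qed
  have "\<i> *\<^sub>C (?m * a - star ?m * star a) = \<i> *\<^sub>C (a * ?m - star a * star ?m)"
    using sym[of "\<i> *\<^sub>C a"]
    by (simp add: star_scaleC scaleC_mult_left scaleC_mult_right scaleC_minus_left
        scaleC_diff_right)
  then have "(- \<i>) *\<^sub>C \<i> *\<^sub>C (?m * a - star ?m * star a) = (- \<i>) *\<^sub>C \<i> *\<^sub>C (a * ?m - star a * star ?m)"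
    by simp
  then have "?m * a - star ?m * star a = a * ?m - star a * star ?m"
    by (simp add: scaleC_scaleC)
  then have "(?m * a - star ?m * star a) + (?m * a + star ?m * star a)
      = (a * ?m - star a * star ?m) + (star a * star ?m + a * ?m)"
    using sym[of a] by (simp only:)
  then have "2 *\<^sub>R (?m * a) = 2 *\<^sub>R (a * ?m)"
    by (simp add: scaleR_2)
  then show "?m * a = a * ?m"
    by simp
qed

theorem theorem2p10:
  fixes M N U V :: "'a::cstar_algebra ^ 'n ^ 'n"
    and d e :: "'n \<Rightarrow> 'a"
  assumes "(wstar_algebra TYPE('a) TYPE('p::complex_banach) \<and> sigma_finite TYPE('a))
             \<or> awstar_algebra TYPE('a)"
    and "matrix_positive M" and "matrix_positive N"
    and "unitary_matrix U" and "unitary_matrix V"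
    and "M = U ** diag d ** matrix_star U"
    and "N = V ** diag e ** matrix_star V"
    and "commutative_set (range d \<union> range e \<union> {U $ l $ m | l m. True} \<union> {V $ r $ s | r s. True})"
  shows "matrix_positive (schur_product M N)"
proof -
  note M = assms(2) and N = assms(3)
  have entry: "schur_product M N $ j $ k = M $ j $ k * N $ j $ k" for j k
    using central_commute[OF matrix_positive_entry_central[OF M], of "N $ j $ k" j k]
    by (simp add: schur_product_def scaleR_half_double)
  have "schur_product M N = matrix_star (schur_product M N)"
    by (simp add: vec_eq_iff matrix_star_def entry star_mult matrix_positive_hermitian[OF M]
        matrix_positive_hermitian[OF N] central_commute[OF matrix_positive_entry_central[OF M]])
  moreover have form: "positive (hform UNIV (\<lambda>j k. A $ j $ k) x)" if "matrix_positive A"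
    for A :: "'a ^ 'n ^ 'n" and x
  proof -
    have "positive (cstar_inner (A *v vec_lambda x) (vec_lambda x))"
      using that by (simp add: matrix_positive_def)
    then show ?thesis
      by (simp add: cstar_inner_eq_hform)
  qed
  have "positive (cstar_inner (schur_product M N *v x) x)" for x
    unfolding cstar_inner_eq_hform entry
    by (intro schur_product_form_positive matrix_positive_entry_central
        matrix_positive_hermitian form M N finite)
  ultimately show ?thesis
    by (simp add: matrix_positive_def)
qed

end
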